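(* Let $X\subseteq\mathbb{R}^n$ be a closed convex set and let $f_0:\mathbb{R}\times X\to\mathbb{R}$ be a cost function such that, for every time horizon $T>0$, $f_0(t,x)$ is integrable with respect to $t$ on $[0,T]$ and convex with respect to $x$ for all $t\in[0,T]$. Let $\varepsilon>0$ and let $x(t)$ be the solution, with $x(0)\in X$, of the online projected gradient controller $$\dot x=\Pi_X\big(x,-\varepsilon f_{0,x}(t,x)\big),$$ where $f_{0,x}(t,x)$ is a subgradient of $f_0(t,\cdot)$ at $x$. Then $x(t)$ is strongly optimal, i.e. there exists a constant $C$ such that for all $T$ the regret $$\mathcal{R}_T=\int_0^T f_0(t,x(t))\,dt-\int_0^T f_0(t,x^* )\,dt,\qquad x^*=\operatorname{argmin}_{x\in X}\int_0^T f_0(t,x)\,dt,$$ satisfies $\mathcal{R}_T\le C$. In particular, the regret can be bounded by $$\mathcal{R}_T\le \frac{1}{\varepsilon}\,V_{x^*}(x(0))\quad\text{for all } T,$$ where $V_{\bar x}(x)=\tfrac12 (x-\bar x)^T(x-\bar x)$.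
   Context: There are no constraints other than $x\in X$ in this problem; $x^*$ is the optimal fixed action in hindsight. Projection: for a closed convex set $X\subseteq\mathbb{R}^n$, $P_X(z)=\operatorname{argmin}_{y\in X}\|y-z\|$ (Euclidean norm), and for $x\in X$, $v\in\mathbb{R}^n$, $\Pi_X(x,v)=\lim_{\delta\to0^+}\big(P_X(x+\delta v)-x\big)/\delta$. Subgradient: for a convex $g:X\to\mathbb{R}$, a subgradient $g_x(x)$ at $x\in X$ is a vector with $g(y)\ge g(x)+g_x(x)^T(y-x)$ for all $y\in X$; subgradients are taken to exist at all points of $X$.
   Formalization: The constant C is claimed uniformly in T only for optima x* (which depend on T) lying in a bounded set, since with x* escaping to infinity the regret can be unbounded; the explicit bound V_{x*}(x(0))/ε is kept for all T and all x*. *)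

theory Defs
  imports "HOL-Analysis.Analysis"
begin

text \<open>The limit exists whenever \<open>X\<close> is closed and convex and \<open>x \<in> X\<close>.\<close>
definition proj_dir :: "(real ^ 'n) set \<Rightarrow> real ^ 'n \<Rightarrow> real ^ 'n \<Rightarrow> real ^ 'n" where
  "proj_dir X x v =
     Lim (at_right 0) (\<lambda>\<delta>. (closest_point X (x + \<delta> *\<^sub>R v) - x) /\<^sub>R \<delta>)"

definition is_subgradient ::
  "(real ^ 'n) set \<Rightarrow> (real ^ 'n \<Rightarrow> real) \<Rightarrow> real ^ 'n \<Rightarrow> real ^ 'n \<Rightarrow> bool" where
  "is_subgradient X h x s \<longleftrightarrow> (\<forall>y\<in>X. h y \<ge> h x + s \<bullet> (y - x))"

text \<open>Each member of the division \<open>\<D>\<close> is a compact interval \<open>{Inf K..Sup K}\<close>,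
  and distinct members have disjoint interiors.\<close>
definition abs_continuous_on_interval ::
  "real \<Rightarrow> real \<Rightarrow> (real \<Rightarrow> real ^ 'n) \<Rightarrow> bool" where
  "abs_continuous_on_interval a b x \<longleftrightarrow>
     (\<forall>e>0. \<exists>d>0. \<forall>\<D>. \<D> division_of \<Union>\<D> \<and> \<Union>\<D> \<subseteq> {a..b} \<and>
        (\<Sum>K\<in>\<D>. Sup K - Inf K) < d \<longrightarrow>
        (\<Sum>K\<in>\<D>. norm (x (Sup K) - x (Inf K))) < e)"

text \<open>The right-hand side is discontinuous in the state (and possibly in time), so solutions are
  understood in the sense of Caratheodory: locally absolutely continuous curves in \<open>X\<close> that
  satisfy the equation for almost every time. The argument \<open>g\<close> is the subgradient selection
  used by the controller.\<close>
definition controller_solution ::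
  "(real ^ 'n) set \<Rightarrow> real \<Rightarrow> (real \<Rightarrow> real ^ 'n \<Rightarrow> real ^ 'n) \<Rightarrow> (real \<Rightarrow> real ^ 'n) \<Rightarrow> bool" where
  "controller_solution X \<epsilon> g x \<longleftrightarrow>
     (\<forall>t\<ge>0. x t \<in> X) \<and>
     (\<forall>T>0. abs_continuous_on_interval 0 T x) \<and>
     (AE t in lebesgue. t > 0 \<longrightarrow>
        (x has_vector_derivative proj_dir X (x t) (- \<epsilon> *\<^sub>R g t (x t))) (at t))"

definition hindsight_opt ::
  "(real ^ 'n) set \<Rightarrow> (real \<Rightarrow> real ^ 'n \<Rightarrow> real) \<Rightarrow> real \<Rightarrow> real ^ 'n \<Rightarrow> bool" where
  "hindsight_opt X f T xs \<longleftrightarrow>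
     is_arg_min (\<lambda>y. LINT t:{0..T}|lebesgue. f t y) (\<lambda>y. y \<in> X) xs"

definition regret ::
  "(real \<Rightarrow> real ^ 'n \<Rightarrow> real) \<Rightarrow> (real \<Rightarrow> real ^ 'n) \<Rightarrow> real \<Rightarrow> real ^ 'n \<Rightarrow> real" where
  "regret f x T xs =
     (LINT t:{0..T}|lebesgue. f t (x t)) - (LINT t:{0..T}|lebesgue. f t xs)"

text \<open>Strong optimality with the hindsight optima, which depend on the horizon \<open>T\<close>, ranging
  over a set \<open>B\<close>; the constant does not depend on \<open>T\<close>. Taking \<open>B = X\<close> puts no restriction on
  the optima, taking a singleton treats the optimum as independent of the horizon. For unbounded
  \<open>B\<close> the hindsight optima may escape to infinity and projected gradient trajectories can have
  unbounded regret.\<close>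
definition strongly_optimal_wrt ::
  "(real ^ 'n) set \<Rightarrow> (real ^ 'n) set \<Rightarrow> (real \<Rightarrow> real ^ 'n \<Rightarrow> real) \<Rightarrow> (real \<Rightarrow> real ^ 'n) \<Rightarrow> bool" where
  "strongly_optimal_wrt B X f x \<longleftrightarrow>
     (\<exists>C. \<forall>T>0. \<forall>xs\<in>B. hindsight_opt X f T xs \<longrightarrow> regret f x T xs \<le> C)"

definition lyap :: "real ^ 'n \<Rightarrow> real ^ 'n \<Rightarrow> real" where
  "lyap xbar x = 1 / 2 * ((x - xbar) \<bullet> (x - xbar))"

end

theory Submission
  imports Defs
begin

text \<open>The quotients defining \<open>\<Pi>\<^sub>X(x, v)\<close> converge to the projection of \<open>v\<close> on the tangent cone
  of \<open>X\<close> at \<open>x\<close>, so \<open>(x - c) \<bullet> \<Pi>\<^sub>X(x, v) \<le> (x - c) \<bullet> v\<close> for every \<open>c \<in> X\<close>. Along a trajectory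
  the subgradient inequality then gives \<open>d/dt V\<^sub>c(x(t)) \<le> - \<epsilon> (f(t, x(t)) - f(t, c))\<close> for almost every
  \<open>t\<close>, and integrating bounds the regret by \<open>V\<^sub>c(x(0)) / \<epsilon>\<close>. The integration rests on two facts:
  the fundamental theorem of calculus for absolutely continuous functions, and the integrability
  of \<open>t \<mapsto> f(t, x(t))\<close>. The latter is essential, since a Bochner integral that does not exist
  takes the value 0: measurability comes from pulling \<open>x(t)\<close> towards a relative interior point
  of \<open>X\<close>, and a lower bound from extrapolating convexity through such a point.\<close>

section \<open>Absolutely continuous functions\<close>

text \<open>Converts smallness of the measure of a cover of the exceptional set into the
  total-length hypothesis of absolute continuity.\<close>

lemma division_of_sum_le_measure:
  fixes U :: "real set"
  assumes "\<D> division_of \<Union>\<D>" and "\<Union>\<D> \<subseteq> U" and "U \<in> lmeasurable"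
  shows "(\<Sum>K\<in>\<D>. Sup K - Inf K) \<le> measure lebesgue U"
proof -
  note div = division_ofD[OF assms(1)]
  have int: "\<exists>u v. K = cbox u v \<and> u \<le> v" if "K \<in> \<D>" for K
    using div(3)[OF that] div(4)[OF that] by fastforce
  have "(\<Sum>K\<in>\<D>. Sup K - Inf K) = (\<Sum>K\<in>\<D>. measure lebesgue K)"
    by (rule sum.cong[OF refl]) (use int in fastforce)
  also have "\<dots> = measure lebesgue (\<Union>\<D>)"
    by (rule content_division[OF assms(1)])
  also have "\<dots> \<le> measure lebesgue U"
    using assms lmeasurable_division[OF assms(1)] by (intro measure_mono_fmeasurable) auto
  finally show ?thesis .
qed

text \<open>Differentiability off a null set alone is too weak, as the Cantor function shows;
  absolute continuity makes the increments over the null set negligible. The integral is the gauge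
  integral, so integrability of \<open>F'\<close> is a conclusion.\<close>

theorem fundamental_theorem_of_calculus_abs_continuous:
  fixes F :: "real \<Rightarrow> 'a::banach"
  assumes "a \<le> b" and "negligible N"
    and AC: "\<And>e. e > 0 \<Longrightarrow> \<exists>d>0. \<forall>\<D>. \<D> division_of \<Union>\<D> \<and> \<Union>\<D> \<subseteq> {a..b} \<and>
        (\<Sum>K\<in>\<D>. Sup K - Inf K) < d \<longrightarrow> (\<Sum>K\<in>\<D>. norm (F (Sup K) - F (Inf K))) < e"
    and vecd: "\<And>t. t \<in> {a..b} - N \<Longrightarrow> (F has_vector_derivative F' t) (at t within {a..b})"
  shows "(F' has_integral (F b - F a)) {a..b}"
proof (rule has_integral_spike[OF \<open>negligible N\<close>])
  \<comment> \<open>With the value 0 on \<open>N\<close>, a tag in \<open>N\<close> contributes only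
    the increment of \<open>F\<close> to the error.\<close>
  let ?f = "\<lambda>t. if t \<in> N then 0 else F' t"
  show "F' t = ?f t" if "t \<in> {a..b} - N" for t
    using that by simp
  show "(?f has_integral (F b - F a)) {a..b}"
  proof (cases "a = b")
    case True
    then show ?thesis using has_integral_refl(1)[of ?f a] by simp
  next
    case False
    with \<open>a \<le> b\<close> have "a < b" by simp
    show ?thesis
      unfolding has_integral_factor_content box_real[symmetric]
    proof safe
      fix e :: real
      assume "e > 0"
      \<comment> \<open>The permitted error is \<open>e * (b - a)\<close>: one half for the tags
        outside \<open>N\<close>, through the slope error \<open>e/2\<close>, and one half for the
        tags in \<open>N\<close>.\<close>
      have "\<forall>t. \<exists>d>0. t \<in> {a..b} - N \<longrightarrow>
           (\<forall>s\<in>{a..b}. norm (s-t) < d \<longrightarrow> norm (F s - F t - (s-t) *\<^sub>R F' t) \<le> e/2 * norm (s-t))"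
        using vecd[unfolded has_vector_derivative_def has_derivative_within_alt] \<open>e > 0\<close>
        by (meson half_gt_zero zero_less_one)
      then obtain d where d: "\<And>t. 0 < d t"
          "\<And>t s. \<lbrakk>t \<in> {a..b} - N; s \<in> {a..b}; norm (s-t) < d t\<rbrakk>
            \<Longrightarrow> norm (F s - F t - (s-t) *\<^sub>R F' t) \<le> e/2 * norm (s-t)"
        by metis
      obtain \<eta> where "\<eta> > 0" and \<eta>: "\<And>\<D>. \<lbrakk>\<D> division_of \<Union>\<D>; \<Union>\<D> \<subseteq> {a..b};
          (\<Sum>K\<in>\<D>. Sup K - Inf K) < \<eta>\<rbrakk> \<Longrightarrow> (\<Sum>K\<in>\<D>. norm (F (Sup K) - F (Inf K))) < e/2 * (b - a)"
        using AC[of "e/2 * (b-a)"] \<open>e > 0\<close> \<open>a < b\<close> by (auto simp: Ball_def)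
      have "N \<in> sets lebesgue"
        using \<open>negligible N\<close> negligible_imp_sets by blast
      then obtain U where U: "open U" "N \<subseteq> U" "U - N \<in> lmeasurable"
          "emeasure lebesgue (U - N) < ennreal \<eta>"
        using sets_lebesgue_outer_open \<open>\<eta> > 0\<close> by metis
      have Umeas: "U \<in> lmeasurable" "measure lebesgue U < \<eta>"
      proof -
        have N: "N \<in> lmeasurable" "measure lebesgue N = 0"
          using \<open>negligible N\<close> negligible_imp_measurable negligible_imp_measure0 by auto
        have eq: "U = (U - N) \<union> N" using U(2) by auto
        show "U \<in> lmeasurable"
          using N(1) U(3) by (subst eq) (rule fmeasurable.Un)
        have "measure lebesgue U \<le> measure lebesgue (U - N) + measure lebesgue N"
          using measure_Un_le[of "U - N" lebesgue N] U(3) N(1) eq by (metis fmeasurableD)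
        moreover have "measure lebesgue (U - N) < \<eta>"
          using U(3,4) \<open>\<eta> > 0\<close> by (simp add: emeasure_eq_measure2 ennreal_less_iff)
        ultimately show "measure lebesgue U < \<eta>" using N(2) by simp
      qed
      \<comment> \<open>Tags in \<open>N\<close> only see intervals inside the small set \<open>U\<close>, whose increments absolute
        continuity controls; the other tags are handled by the straddle lemma.\<close>
      define \<gamma> where "\<gamma> = (\<lambda>t. if t \<in> N then U else ball t (d t))"
      have \<gamma>: "gauge \<gamma>"
        using U(1,2) d(1) by (auto simp: \<gamma>_def gauge_def)
      have est: "norm ((\<Sum>(t, K)\<in>p. measure lborel K *\<^sub>R ?f t) - (F b - F a)) \<le> e * measure lborel (cbox a b)"
        if ptag: "p tagged_division_of (cbox a b)" and fine: "\<gamma> fine p" for p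
      proof -
        define q where "q = {tK \<in> p. fst tK \<in> N}"
        have "finite p" "q \<subseteq> p"
          using ptag by (auto simp: q_def)
        have ba: "b - a = (\<Sum>(t,K)\<in>p. Sup K - Inf K)" "F b - F a = (\<Sum>(t,K)\<in>p. F(Sup K) - F(Inf K))"
          using additive_tagged_division_1[where f= "\<lambda>x. x"] additive_tagged_division_1[where f= F]
            \<open>a \<le> b\<close> ptag by auto
        have int: "\<exists>u v. K = cbox u v \<and> u \<le> v \<and> t \<in> K \<and> K \<subseteq> {a..b} \<and> K \<subseteq> \<gamma> t" if "(t, K) \<in> p" for t K
        proof -
          have "t \<in> K" "K \<subseteq> cbox a b" "\<exists>u v. K = cbox u v"
            using tagged_division_ofD(2,3,4)[OF ptag that] by auto
          moreover have "K \<subseteq> \<gamma> t" using fine that by (auto simp: fine_def)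
          ultimately show ?thesis by fastforce
        qed
        have good: "norm (measure lborel K *\<^sub>R ?f t - (F (Sup K) - F (Inf K))) \<le> e/2 * (Sup K - Inf K)"
          if tK: "(t, K) \<in> p - q" for t K
        proof -
          have "t \<notin> N" using tK by (auto simp: q_def)
          obtain u v where uv: "K = cbox u v" "u \<le> v" "t \<in> K" "K \<subseteq> {a..b}" "K \<subseteq> ball t (d t)"
            using int[of t K] tK \<open>t \<notin> N\<close> by (auto simp: \<gamma>_def)
          have t: "t \<in> {a..b} - N" and u: "u \<in> {a..b}" "norm (u - t) < d t"
            and v: "v \<in> {a..b}" "norm (v - t) < d t"
          proof -
            have "u \<in> K" "v \<in> K" using uv(1,2) by auto
            then have "u \<in> {a..b}" "v \<in> {a..b}" "t \<in> {a..b}" "u \<in> ball t (d t)" "v \<in> ball t (d t)"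
              using uv(3-5) by blast+
            then show "t \<in> {a..b} - N" "u \<in> {a..b}" "norm (u - t) < d t" "v \<in> {a..b}" "norm (v - t) < d t"
              using \<open>t \<notin> N\<close> by (auto simp: dist_real_def)
          qed
          have "norm ((v - u) *\<^sub>R F' t - (F v - F u))
             = norm (F u - F t - (u - t) *\<^sub>R F' t - (F v - F t - (v - t) *\<^sub>R F' t))"
            by (auto simp: algebra_simps)
          also have "\<dots> \<le> norm (F u - F t - (u - t) *\<^sub>R F' t) + norm (F v - F t - (v - t) *\<^sub>R F' t)"
            by (rule norm_triangle_ineq4)
          also have "\<dots> \<le> e/2 * norm (u - t) + e/2 * norm (v - t)"
            using d(2)[OF t u] d(2)[OF t v] by (rule add_mono)
          \<comment> \<open>The tag lies between the endpoints, so its distances to them add up to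
            the length of the interval.\<close>
          also have "\<dots> = e/2 * (v - u)"
            using uv(1,3) by (auto simp: field_simps)
          finally show ?thesis using \<open>t \<notin> N\<close> uv(1,2) by simp
        qed
        have bad: "(\<Sum>(t,K)\<in>q. norm (F (Sup K) - F (Inf K))) < e/2 * (b - a)"
        proof -
          have qtag: "q tagged_partial_division_of cbox a b"
            using tagged_partial_division_subset[OF _ \<open>q \<subseteq> p\<close>] ptag
            by (auto simp: tagged_division_of_def)
          have div: "(snd ` q) division_of \<Union>(snd ` q)"
            by (rule partial_division_of_tagged_division[OF qtag])
          have sub: "\<Union>(snd ` q) \<subseteq> {a..b}" "\<Union>(snd ` q) \<subseteq> U"
            using int \<open>q \<subseteq> p\<close> by (fastforce simp: q_def \<gamma>_def)+
          have "(\<Sum>(t,K)\<in>q. norm (F (Sup K) - F (Inf K))) = (\<Sum>K\<in>snd ` q. norm (F (Sup K) - F (Inf K)))"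
          proof -
            \<comment> \<open>Two tags can share an interval only if its interior is empty, and then
              its increment is 0. The case \<open>K = {}\<close> covers \<open>cbox u v\<close> with
              \<open>u > v\<close>, where \<open>Sup\<close> and \<open>Inf\<close> carry no
              information.\<close>
            have "(\<Sum>(t,K)\<in>q. if K = {} then 0 else norm (F (Sup K) - F (Inf K)))
               = (\<Sum>K\<in>snd ` q. if K = {} then 0 else norm (F (Sup K) - F (Inf K)))"
              by (rule sum.over_tagged_division_lemma[OF tagged_partial_division_of_Union_self[OF qtag]])
                 (auto simp: not_less)
            moreover have "K \<noteq> {}" if "(t,K) \<in> q" for t K
              using int \<open>q \<subseteq> p\<close> that by blast
            ultimately show ?thesis
              by (smt (verit) case_prod_beta imageE prod.collapse sum.cong)
          qed
          also have "\<dots> < e/2 * (b - a)"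
            using division_of_sum_le_measure[OF div sub(2) Umeas(1)] Umeas(2)
            by (intro \<eta>[OF div sub(1)]) simp
          finally show ?thesis .
        qed
        have "(\<Sum>(t, K)\<in>p. measure lborel K *\<^sub>R ?f t) - (F b - F a)
            = (\<Sum>(t, K)\<in>p. measure lborel K *\<^sub>R ?f t - (F (Sup K) - F (Inf K)))"
          by (simp add: ba(2) split_def sum_subtractf)
        also have "\<dots> = (\<Sum>(t, K)\<in>p - q. measure lborel K *\<^sub>R ?f t - (F (Sup K) - F (Inf K)))
            + (\<Sum>(t, K)\<in>q. measure lborel K *\<^sub>R ?f t - (F (Sup K) - F (Inf K)))"
          by (rule sum.subset_diff[OF \<open>q \<subseteq> p\<close> \<open>finite p\<close>])
        also have "norm \<dots> \<le> (\<Sum>(t, K)\<in>p - q. e/2 * (Sup K - Inf K))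
            + (\<Sum>(t, K)\<in>q. norm (F (Sup K) - F (Inf K)))"
        proof (intro norm_triangle_mono sum_norm_le)
          show "norm (case tK of (t, K) \<Rightarrow> measure lborel K *\<^sub>R ?f t - (F (Sup K) - F (Inf K)))
              \<le> (case tK of (t, K) \<Rightarrow> e/2 * (Sup K - Inf K))" if "tK \<in> p - q" for tK
            using good that by (cases tK) auto
          show "norm (case tK of (t, K) \<Rightarrow> measure lborel K *\<^sub>R ?f t - (F (Sup K) - F (Inf K)))
              \<le> (case tK of (t, K) \<Rightarrow> norm (F (Sup K) - F (Inf K)))" if "tK \<in> q" for tK
            using that by (cases tK) (auto simp: q_def norm_minus_commute)
        qed
        also have "(\<Sum>(t, K)\<in>p - q. e/2 * (Sup K - Inf K)) \<le> (\<Sum>(t, K)\<in>p. e/2 * (Sup K - Inf K))"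
          using int \<open>e > 0\<close> \<open>finite p\<close> by (intro sum_mono2) (auto, fastforce)
        also have "\<dots> = e/2 * (b - a)"
          by (simp add: ba(1) sum_distrib_left split_def)
        finally show ?thesis using bad \<open>a \<le> b\<close> by simp
      qed
      show "\<exists>\<gamma>. gauge \<gamma> \<and> (\<forall>p. p tagged_division_of (cbox a b) \<and> \<gamma> fine p \<longrightarrow>
        norm ((\<Sum>(t, K)\<in>p. measure lborel K *\<^sub>R ?f t) - (F b - F a)) \<le> e * measure lborel (cbox a b))"
        by (intro exI[of _ \<gamma>] conjI allI impI \<gamma>) (elim conjE, rule est)
    qed
  qed
qed

section \<open>Convex functions on the relative interior\<close>

text \<open>An affine basis of \<open>X\<close> spans a simplex with the same affine hull, so the
  simplex has a relative interior point. A convex function is thus controlled on a whole relative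
  ball by finitely many of its values.\<close>

lemma finite_hull_rel_interior:
  fixes X :: "'a::euclidean_space set"
  assumes "X \<noteq> {}"
  obtains B q r where "finite B" "B \<subseteq> X" "q \<in> convex hull B" "r > 0"
    "cball q r \<inter> affine hull X \<subseteq> convex hull B"
proof -
  obtain B where B: "B \<subseteq> X" "\<not> affine_dependent B" "affine hull X = affine hull B"
    using affine_basis_exists[of X] by blast
  then have "B \<noteq> {}" using assms by auto
  then obtain q where "q \<in> rel_interior (convex hull B)"
    using rel_interior_eq_empty[OF convex_convex_hull, of B] by auto
  then obtain r where "q \<in> convex hull B" "r > 0" "cball q r \<inter> affine hull (convex hull B) \<subseteq> convex hull B"
    by (auto simp: mem_rel_interior_cball)
  then show ?thesis
    using that[of B q r] B aff_independent_finite by auto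
qed

lemma affine_hull_add_diff:
  fixes S :: "'a::real_vector set"
  assumes "y \<in> affine hull S" "u \<in> affine hull S" "w \<in> affine hull S"
  shows "y + c *\<^sub>R (u - w) \<in> affine hull S"
  using mem_affine_3_minus[OF affine_affine_hull assms] .

text \<open>A convex function on a hull is bounded by its values at the generators. A sum of
  absolute values is used as the bound because it is clearly integrable in time when the function is
  \<open>f t\<close>.\<close>

lemma convex_on_le_sum_abs:
  assumes "finite B" "convex_on (convex hull B) f" "w \<in> convex hull B"
  shows "f w \<le> (\<Sum>b\<in>B. \<bar>f b\<bar>)"
proof -
  have "f b \<le> (\<Sum>b\<in>B. \<bar>f b\<bar>)" if "b \<in> B" for b
    using member_le_sum[of b B "\<lambda>b. \<bar>f b\<bar>"] that assms(1) by simp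
  then show ?thesis
    using convex_on_convex_hull_bound[OF assms(2)] assms(3) by blast
qed

text \<open>The point \<open>q\<close> lies between \<open>x\<close> and a point beyond
  \<open>q\<close>; the convexity inequality at \<open>q\<close> is solved for
  \<open>f x\<close>.\<close>

lemma convex_on_ge_extrapolation:
  assumes f: "convex_on X f" and "x \<in> X" and "\<delta> > 0" and w: "q + \<delta> *\<^sub>R (q - x) \<in> X"
  shows "f x \<ge> ((1 + \<delta>) * f q - f (q + \<delta> *\<^sub>R (q - x))) / \<delta>"
proof -
  \<comment> \<open>The weight that expresses \<open>q\<close> as a convex combination of
    \<open>x\<close> and the point beyond it.\<close>
  define l where "l = 1 / (1 + \<delta>)"
  have l: "0 \<le> l" "l \<le> 1" "l * (1 + \<delta>) = 1" "1 - l = l * \<delta>"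
    using \<open>\<delta> > 0\<close> by (auto simp: l_def field_simps)
  have "q = (1 - l) *\<^sub>R x + l *\<^sub>R (q + \<delta> *\<^sub>R (q - x))"
  proof -
    have "(1 - l) *\<^sub>R x + l *\<^sub>R (q + \<delta> *\<^sub>R (q - x)) = (l * (1 + \<delta>)) *\<^sub>R q"
      by (simp only: l(4)) (simp add: algebra_simps)
    then show ?thesis using l(3) by simp
  qed
  then have "f q \<le> (1 - l) * f x + l * f (q + \<delta> *\<^sub>R (q - x))"
    using convex_onD[OF f l(1,2) \<open>x \<in> X\<close> w] by simp
  then have "(1 + \<delta>) * f q \<le> (1 + \<delta>) * ((1 - l) * f x + l * f (q + \<delta> *\<^sub>R (q - x)))"
    using \<open>\<delta> > 0\<close> by (intro mult_left_mono) auto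
  also have "\<dots> = (l * (1 + \<delta>)) * (\<delta> * f x + f (q + \<delta> *\<^sub>R (q - x)))"
    by (simp only: l(4)) (simp add: algebra_simps)
  finally have "(1 + \<delta>) * f q - f (q + \<delta> *\<^sub>R (q - x)) \<le> \<delta> * f x"
    using l(3) by simp
  then show ?thesis using \<open>\<delta> > 0\<close> by (simp add: field_simps)
qed

text \<open>An upper bound on a relative ball suffices: convexity on the ray from \<open>y\<close>
  through \<open>z\<close> bounds \<open>f z - f y\<close> above, and the reflected ray bounds it
  below, both by a multiple of \<open>dist z y\<close>.\<close>

lemma convex_on_rel_bounded_above_imp_continuous:
  fixes X :: "'a::real_normed_vector set"
  assumes f: "convex_on X f" and "y \<in> X" and "\<rho> > 0"
    and sub: "cball y \<rho> \<inter> affine hull X \<subseteq> X"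
    and M: "\<And>w. w \<in> cball y \<rho> \<inter> affine hull X \<Longrightarrow> f w \<le> M"
  shows "continuous (at y within X) f"
proof -
  have aff: "z \<in> affine hull X" if "z \<in> X" for z
    using that hull_inc by metis
  have "f y \<le> M" using M[of y] aff \<open>y \<in> X\<close> \<open>\<rho> > 0\<close> by auto
  have bnd: "\<bar>f z - f y\<bar> \<le> dist z y / \<rho> * (M - f y)" if "z \<in> X" "dist z y \<le> \<rho>" for z
  proof (cases "z = y")
    case False
    \<comment> \<open>Stretching \<open>z - y\<close> by \<open>1/m\<close> reaches the sphere of
      radius \<open>\<rho>\<close>, so \<open>z\<close> is the point at fraction \<open>m\<close> of
      the way from \<open>y\<close> to that sphere.\<close>
    define m where "m = dist z y / \<rho>"
    have m: "0 < m" "m \<le> 1" using that False \<open>\<rho> > 0\<close> by (auto simp: m_def)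
    have w: "y + c *\<^sub>R (z - y) \<in> cball y \<rho> \<inter> affine hull X" if "\<bar>c\<bar> = 1/m" for c
      using affine_hull_add_diff[of y X z y c] aff \<open>z \<in> X\<close> \<open>y \<in> X\<close> that False \<open>\<rho> > 0\<close>
      by (auto simp: dist_norm m_def norm_minus_commute)
    have "(1 - m) *\<^sub>R y + m *\<^sub>R (y + (1/m) *\<^sub>R (z - y)) = z"
      using m by (simp add: algebra_simps)
    then have "f z \<le> (1 - m) * f y + m * f (y + (1/m) *\<^sub>R (z - y))"
      using convex_onD[OF f _ _ \<open>y \<in> X\<close>, of m "y + (1/m) *\<^sub>R (z - y)"] w[of "1/m"] sub m by auto
    also have "m * f (y + (1/m) *\<^sub>R (z - y)) \<le> m * M"
      using M[OF w[of "1/m"]] m by (intro mult_left_mono) auto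
    finally have "f z \<le> (1 - m) * f y + m * M" by simp
    then have upper: "f z - f y \<le> m * (M - f y)" by (simp add: algebra_simps)
    \<comment> \<open>The reflected boundary point serves as the far point of the extrapolation from
      \<open>z\<close> through \<open>y\<close>.\<close>
    have eq: "y + (1/m) *\<^sub>R (y - z) = y + (-1/m) *\<^sub>R (z - y)"
      by (simp add: algebra_simps)
    have w': "y + (1/m) *\<^sub>R (y - z) \<in> cball y \<rho> \<inter> affine hull X"
      unfolding eq using m by (intro w) simp
    then have "((1 + 1/m) * f y - f (y + (1/m) *\<^sub>R (y - z))) / (1/m) \<le> f z"
      using convex_on_ge_extrapolation[OF f \<open>z \<in> X\<close>, of "1/m" y] m sub by auto
    then have "m * ((1 + 1/m) * f y - f (y + (1/m) *\<^sub>R (y - z))) \<le> f z"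
      by (simp add: mult.commute)
    moreover have "m * ((1 + 1/m) * f y - f (y + (1/m) *\<^sub>R (y - z))) \<ge> m * ((1 + 1/m) * f y - M)"
      using M[OF w'] m by (intro mult_left_mono) auto
    moreover have "m * ((1 + 1/m) * f y - M) = f y - m * (M - f y)"
      using m by (simp add: field_simps)
    ultimately have "f y - f z \<le> m * (M - f y)" by linarith
    with upper show ?thesis by (simp add: m_def)
  qed simp
  have "((\<lambda>z. dist z y / \<rho> * (M - f y)) \<longlongrightarrow> dist y y / \<rho> * (M - f y)) (at y within X)"
    using \<open>\<rho> > 0\<close> by (intro tendsto_intros) auto
  then have "((\<lambda>z. dist z y / \<rho> * (M - f y)) \<longlongrightarrow> 0) (at y within X)"
    by simp
  moreover have "\<forall>\<^sub>F z in at y within X. norm (f z - f y) \<le> dist z y / \<rho> * (M - f y)"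
    using bnd \<open>\<rho> > 0\<close> by (auto simp: eventually_at intro!: exI[of _ \<rho>])
  ultimately have "((\<lambda>z. f z - f y) \<longlongrightarrow> 0) (at y within X)"
    by (rule Lim_null_comparison[rotated])
  then show ?thesis
    by (simp add: continuous_within LIM_zero_iff)
qed

text \<open>Prolonging the segment from \<open>q\<close> through \<open>y\<close> gives a point
  \<open>p\<close> of \<open>X\<close>. The homothety centred at \<open>p\<close> that sends
  \<open>q\<close> to \<open>y\<close> carries the simplex onto a relative neighbourhood of
  \<open>y\<close>, and convexity transports the upper bound with it.\<close>

theorem convex_on_continuous_rel_interior:
  fixes f :: "'a::euclidean_space \<Rightarrow> real"
  assumes f: "convex_on X f"
  shows "continuous_on (rel_interior X) f"
proof (cases "X = {}")
  case False
  have "convex X" using f convex_on_imp_convex by blast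
  obtain B q r where B: "finite B" "B \<subseteq> X" "q \<in> convex hull B" "r > 0"
    "cball q r \<inter> affine hull X \<subseteq> convex hull B"
    using finite_hull_rel_interior[OF False] by blast
  have hull: "convex hull B \<subseteq> X" using B(2) \<open>convex X\<close> by (rule hull_minimal)
  have aff: "z \<in> affine hull X" if "z \<in> X" for z
    using that hull_inc by metis
  have "continuous (at y within X) f" if y: "y \<in> rel_interior X" for y
  proof -
    obtain e where e: "y \<in> X" "e > 0" "cball y e \<inter> affine hull X \<subseteq> X"
      using y by (auto simp: mem_rel_interior_cball)
    \<comment> \<open>Small enough that \<open>p\<close> stays within distance \<open>e\<close> of
      \<open>y\<close>; the summand 1 covers \<open>y = q\<close>.\<close>
    define d where "d = e / (norm (y - q) + 1)"
    have "d > 0" using e(2) by (simp add: d_def add_nonneg_pos)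
    define p where "p = y + d *\<^sub>R (y - q)"
    have "q \<in> X" using B(3) hull by auto
    have "p \<in> X"
    proof -
      have "d * norm (y - q) \<le> e"
        using e(2) by (simp add: d_def divide_simps add_nonneg_pos)
      then show ?thesis
        using e affine_hull_add_diff[of y X y q d] aff \<open>q \<in> X\<close> \<open>d > 0\<close>
        by (intro subsetD[OF e(3)]) (auto simp: p_def dist_norm)
    qed
    define l where "l = d / (1 + d)"
    have l: "0 < l" "l < 1" using \<open>d > 0\<close> by (auto simp: l_def field_simps)
    have y_eq: "y = (1 - l) *\<^sub>R p + l *\<^sub>R q"
    proof -
      have "(1 - l) *\<^sub>R p + l *\<^sub>R q = ((1 - l) * (1 + d)) *\<^sub>R y + (l - (1 - l) * d) *\<^sub>R q"
        by (simp add: p_def algebra_simps)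
      moreover have "(1 - l) * (1 + d) = 1" "l - (1 - l) * d = 0"
        using \<open>d > 0\<close> by (auto simp: l_def field_simps)
      ultimately show ?thesis by simp
    qed
    \<comment> \<open>The point \<open>q + (1/l) *\<^sub>R (w - y)\<close> is the preimage of
      \<open>w\<close> under the homothety of ratio \<open>l\<close>, hence the radius
      \<open>l * r\<close> around \<open>y\<close>.\<close>
    have in_hull: "q + (1/l) *\<^sub>R (w - y) \<in> convex hull B" and w_eq: "w = (1 - l) *\<^sub>R p + l *\<^sub>R (q + (1/l) *\<^sub>R (w - y))"
      if "w \<in> cball y (l * r) \<inter> affine hull X" for w
    proof -
      have "norm ((1/l) *\<^sub>R (w - y)) \<le> r"
        using that l by (simp add: dist_norm norm_minus_commute[of y] divide_le_eq mult.commute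
            del: scaleR_right_diff_distrib)
      then have "q + (1/l) *\<^sub>R (w - y) \<in> cball q r"
        by (simp only: mem_cball dist_norm norm_minus_commute[of q] add_diff_cancel_left')
      then show "q + (1/l) *\<^sub>R (w - y) \<in> convex hull B"
        using affine_hull_add_diff[of q X w y "1/l"] that aff e(1) \<open>q \<in> X\<close>
        by (intro subsetD[OF B(5)]) auto
      show "w = (1 - l) *\<^sub>R p + l *\<^sub>R (q + (1/l) *\<^sub>R (w - y))"
        using l y_eq by (simp add: algebra_simps)
    qed
    show ?thesis
    proof (rule convex_on_rel_bounded_above_imp_continuous[OF f e(1)])
      show "0 < l * r" using l B(4) by simp
      show "cball y (l * r) \<inter> affine hull X \<subseteq> X"
      proof
        fix w assume w: "w \<in> cball y (l * r) \<inter> affine hull X"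
        have "(1 - l) *\<^sub>R p + l *\<^sub>R (q + (1/l) *\<^sub>R (w - y)) \<in> X"
          using in_hull[OF w] hull l \<open>p \<in> X\<close> by (intro convexD[OF \<open>convex X\<close>]) auto
        then show "w \<in> X" using w_eq[OF w] by simp
      qed
      show "f w \<le> (1 - l) * f p + l * (\<Sum>b\<in>B. \<bar>f b\<bar>)" if w: "w \<in> cball y (l * r) \<inter> affine hull X" for w
      proof -
        have "f w \<le> (1 - l) * f p + l * f (q + (1/l) *\<^sub>R (w - y))"
          using convex_onD[OF f, of l p "q + (1/l) *\<^sub>R (w - y)"] in_hull[OF w] hull l \<open>p \<in> X\<close> w_eq[OF w]
          by auto
        also have "f (q + (1/l) *\<^sub>R (w - y)) \<le> (\<Sum>b\<in>B. \<bar>f b\<bar>)"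
          by (rule convex_on_le_sum_abs[OF B(1) convex_on_subset[OF f hull convex_convex_hull] in_hull[OF w]])
        finally show ?thesis using l by simp
      qed
    qed
  qed
  then show ?thesis
    using continuous_within_subset[OF _ rel_interior_subset] by (auto simp: continuous_on_eq_continuous_within)
qed simp

text \<open>The data \<open>B\<close>, \<open>q\<close>, \<open>c\<close>, \<open>k\<close> are
  chosen before \<open>h\<close>. Applied to all \<open>f t\<close> at once, the bound is a fixed
  combination of finitely many functions of time, which is integrable.\<close>

lemma convex_on_bounded_subset_lower_bound:
  fixes X S :: "'a::euclidean_space set"
  assumes "convex X" "S \<subseteq> X" "bounded S" "S \<noteq> {}"
  obtains B q c k where "finite B" "B \<subseteq> X" "q \<in> X"
    "\<And>h x. convex_on X h \<Longrightarrow> x \<in> S \<Longrightarrow> c * h q - k * (\<Sum>b\<in>B. \<bar>h b\<bar>) \<le> h x"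
proof -
  have "X \<noteq> {}" using assms by auto
  then obtain B q r where B: "finite B" "B \<subseteq> X" "q \<in> convex hull B" "r > 0"
    "cball q r \<inter> affine hull X \<subseteq> convex hull B"
    using finite_hull_rel_interior by metis
  have hull: "convex hull B \<subseteq> X" using B(2) \<open>convex X\<close> by (rule hull_minimal)
  then have "q \<in> X" using B(3) by auto
  obtain R where R: "R > 0" "\<And>x. x \<in> S \<Longrightarrow> norm (q - x) \<le> R"
  proof -
    obtain R0 where R0: "\<And>y. y \<in> S \<Longrightarrow> dist q y \<le> R0"
      using \<open>bounded S\<close> bounded_any_center[of S q] by blast
    have "norm (q - y) \<le> max 1 R0" if "y \<in> S" for y
      using R0[OF that] by (simp add: dist_norm)
    moreover have "max 1 R0 > 0" by simp
    ultimately show thesis using that by blast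
  qed
  \<comment> \<open>Since \<open>S\<close> lies within distance \<open>R\<close> of
    \<open>q\<close>, overshooting \<open>q\<close> by the factor \<open>r / R\<close> stays in the
    ball of radius \<open>r\<close>.\<close>
  define \<delta> where "\<delta> = r / R"
  have "\<delta> > 0" using B R by (simp add: \<delta>_def)
  show ?thesis
  proof (rule that[of B q "(1 + \<delta>) / \<delta>" "1 / \<delta>"])
    fix h x assume h: "convex_on X h" and x: "x \<in> S"
    have "x \<in> X" using x assms by auto
    have "\<delta> * norm (q - x) \<le> \<delta> * R" using R(2)[OF x] \<open>\<delta> > 0\<close> by simp
    also have "\<dots> = r" using R by (simp add: \<delta>_def)
    finally have w: "q + \<delta> *\<^sub>R (q - x) \<in> convex hull B"
      using affine_hull_add_diff[of q X q x \<delta>] \<open>q \<in> X\<close> \<open>x \<in> X\<close> \<open>\<delta> > 0\<close>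
      by (intro subsetD[OF B(5)]) (auto simp: dist_norm hull_inc)
    have "h (q + \<delta> *\<^sub>R (q - x)) \<le> (\<Sum>b\<in>B. \<bar>h b\<bar>)"
      by (rule convex_on_le_sum_abs[OF B(1) convex_on_subset[OF h hull convex_convex_hull] w])
    then have "((1 + \<delta>) * h q - (\<Sum>b\<in>B. \<bar>h b\<bar>)) / \<delta> \<le> ((1 + \<delta>) * h q - h (q + \<delta> *\<^sub>R (q - x))) / \<delta>"
      using \<open>\<delta> > 0\<close> by (intro divide_right_mono) auto
    also have "\<dots> \<le> h x"
      using convex_on_ge_extrapolation[OF h \<open>x \<in> X\<close> \<open>\<delta> > 0\<close>] w hull by blast
    finally show "(1 + \<delta>) / \<delta> * h q - 1 / \<delta> * (\<Sum>b\<in>B. \<bar>h b\<bar>) \<le> h x"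
      by (simp add: diff_divide_distrib)
  qed (use B \<open>q \<in> X\<close> in auto)
qed

section \<open>Measurability of Caratheodory compositions\<close>

text \<open>Sampling \<open>y\<close> on a time grid leaves countably many fixed states, each giving
  a measurable function of time. Refining the grid recovers the composition by continuity in the
  state.\<close>

lemma borel_measurable_caratheodory_comp:
  fixes f :: "real \<Rightarrow> 'a::topological_space \<Rightarrow> real" and y :: "real \<Rightarrow> 'a"
  assumes meas: "\<And>c. c \<in> S \<Longrightarrow> (\<lambda>t. f t c) \<in> borel_measurable (lebesgue_on {a..b})"
    and cont: "\<And>t. t \<in> {a..b} \<Longrightarrow> continuous_on S (f t)"
    and y: "continuous_on {a..b} y" "y ` {a..b} \<subseteq> S"
  shows "(\<lambda>t. f t (y t)) \<in> borel_measurable (lebesgue_on {a..b})"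
proof (cases "a \<le> b")
  case True
  \<comment> \<open>The index \<open>k n t\<close> selects the last grid point of mesh
    \<open>1 / Suc n\<close> not after \<open>t\<close>. The cut at \<open>b\<close> keeps
    \<open>s n i\<close> in the interval for every \<open>i\<close>, including indices that are
    never selected there.\<close>
  define s where "s n i = min b (a + real i / real (Suc n))" for n i :: nat
  define k where "k n t = nat \<lfloor>real (Suc n) * (t - a)\<rfloor>" for n t
  have s_in: "s n i \<in> {a..b}" for n i using True by (auto simp: s_def)
  show ?thesis
  proof (rule borel_measurable_LIMSEQ_real)
    show "(\<lambda>t. f t (y (s n (k n t)))) \<in> borel_measurable (lebesgue_on {a..b})" for n
    proof (rule measurable_compose_countable[where g = "k n" and f = "\<lambda>i t. f t (y (s n i))"])
      show "(\<lambda>t. f t (y (s n i))) \<in> borel_measurable (lebesgue_on {a..b})" for i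
        using meas s_in y(2) by blast
      have "k n \<in> measurable borel (count_space UNIV)"
        unfolding k_def by measurable
      then have "k n \<in> measurable lebesgue (count_space UNIV)"
        using measurable_completion measurable_lborel2 by (metis measurable_lborel1)
      then show "k n \<in> measurable (lebesgue_on {a..b}) (count_space UNIV)"
        by (rule measurable_restrict_space1)
    qed
    fix t assume "t \<in> space (lebesgue_on {a..b})"
    then have t: "t \<in> {a..b}" by simp
    have lim: "(\<lambda>n. s n (k n t)) \<longlonglongrightarrow> t"
    proof (rule tendsto_sandwich)
      have eq: "s n (k n t) = min b (a + real_of_int \<lfloor>real (Suc n) * (t - a)\<rfloor> / real (Suc n))" for n
        using t by (simp add: s_def k_def)
      have "t - 1 / real (Suc n) \<le> s n (k n t) \<and> s n (k n t) \<le> t" for n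
      proof -
        have "real_of_int \<lfloor>real (Suc n) * (t - a)\<rfloor> / real (Suc n) \<le> real (Suc n) * (t - a) / real (Suc n)"
          by (intro divide_right_mono) auto
        moreover have "(real (Suc n) * (t - a) - 1) / real (Suc n) \<le> real_of_int \<lfloor>real (Suc n) * (t - a)\<rfloor> / real (Suc n)"
          by (intro divide_right_mono) linarith+
        ultimately show ?thesis
          unfolding eq using t by (simp add: diff_divide_distrib del: of_nat_Suc)
      qed
      then show "\<forall>\<^sub>F n in sequentially. t - 1 / real (Suc n) \<le> s n (k n t)"
        "\<forall>\<^sub>F n in sequentially. s n (k n t) \<le> t" by auto
      show "(\<lambda>n. t - 1 / real (Suc n)) \<longlonglongrightarrow> t"
        using tendsto_diff[OF tendsto_const LIMSEQ_inverse_real_of_nat, of t] by (simp add: divide_inverse)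
    qed simp
    have "continuous_on {a..b} (\<lambda>s. f t (y s))"
      by (rule continuous_on_compose2[OF cont[OF t] y])
    then show "(\<lambda>n. f t (y (s n (k n t)))) \<longlonglongrightarrow> f t (y t)"
      by (rule continuous_on_tendsto_compose[OF _ lim t]) (use s_in in auto)
  qed
next
  case False
  then show ?thesis by (intro borel_measurableI) (auto simp: sets_restrict_space)
qed

section \<open>Directional derivative of the projection\<close>

text \<open>The angle at the projection is not acute. This turns convergence of distances to a
  convex set into convergence of points.\<close>

lemma closest_point_dist_sq_le:
  fixes S :: "'a::euclidean_space set"
  assumes "convex S" "closed S" "y \<in> S"
  shows "(dist y (closest_point S a))\<^sup>2 \<le> (dist a y)\<^sup>2 - (dist a (closest_point S a))\<^sup>2"
proof -
  let ?p = "closest_point S a"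
  have "(dist a y)\<^sup>2 - (dist a ?p)\<^sup>2 - (dist y ?p)\<^sup>2 = - 2 * ((a - ?p) \<bullet> (y - ?p))"
    by (simp add: dist_norm power2_norm_eq_inner algebra_simps inner_commute)
  with closest_point_dot[OF assms, of a] show ?thesis by linarith
qed

text \<open>The quotient is the projection of \<open>v\<close> on \<open>(X - x) / \<delta>\<close>, and these sets increase to a dense
  subset of the tangent cone \<open>T\<close> as \<open>\<delta>\<close> decreases to 0.\<close>

lemma tendsto_closest_point_difference_quotient:
  fixes X :: "'a::euclidean_space set"
  assumes "closed X" "convex X" "x \<in> X"
  defines "T \<equiv> closure (\<Union>\<delta>\<in>{0<..}. (\<lambda>y. (y - x) /\<^sub>R \<delta>) ` X)"
  shows "((\<lambda>\<delta>. (closest_point X (x + \<delta> *\<^sub>R v) - x) /\<^sub>R \<delta>) \<longlongrightarrow> closest_point T v) (at_right 0)"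
proof -
  define U where "U = (\<Union>\<delta>\<in>{0<..}. (\<lambda>y. (y - x) /\<^sub>R \<delta>) ` X)"
  define q where "q = (\<lambda>\<delta>. (closest_point X (x + \<delta> *\<^sub>R v) - x) /\<^sub>R \<delta>)"
  define p where "p = closest_point T v"
  \<comment> \<open>The segment from \<open>x\<close> to a point of \<open>X\<close> stays in
    \<open>X\<close>, so the sets \<open>(X - x) / \<delta>\<close> grow as \<open>\<delta>\<close>
    decreases.\<close>
  have mono: "x + \<delta> *\<^sub>R c \<in> X" if "0 \<le> \<delta>" "\<delta> \<le> \<delta>'" "x + \<delta>' *\<^sub>R c \<in> X" for \<delta> \<delta>' c
  proof (cases "\<delta>' = 0")
    case False
    with that have "0 < \<delta>'" by simp
    have "(1 - \<delta>/\<delta>') *\<^sub>R x + (\<delta>/\<delta>') *\<^sub>R (x + \<delta>' *\<^sub>R c) \<in> X"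
      using that \<open>0 < \<delta>'\<close> assms by (intro convexD) auto
    also have "(1 - \<delta>/\<delta>') *\<^sub>R x + (\<delta>/\<delta>') *\<^sub>R (x + \<delta>' *\<^sub>R c) = x + \<delta> *\<^sub>R c"
      using \<open>0 < \<delta>'\<close> by (simp add: algebra_simps)
    finally show ?thesis .
  qed (use that in auto)
  have U: "c \<in> U \<longleftrightarrow> (\<exists>\<delta>>0. x + \<delta> *\<^sub>R c \<in> X)" for c
  proof
    assume "c \<in> U"
    then obtain \<delta> y where "\<delta> > 0" "y \<in> X" "c = (y - x) /\<^sub>R \<delta>" by (auto simp: U_def)
    then show "\<exists>\<delta>>0. x + \<delta> *\<^sub>R c \<in> X" by (intro exI[of _ \<delta>]) auto
  next
    assume "\<exists>\<delta>>0. x + \<delta> *\<^sub>R c \<in> X"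
    then obtain \<delta> where "\<delta> > 0" "x + \<delta> *\<^sub>R c \<in> X" by blast
    then show "c \<in> U" unfolding U_def by (intro UN_I[of \<delta>] image_eqI[of _ _ "x + \<delta> *\<^sub>R c"]) auto
  qed
  have "convex U"
  proof (rule convexI)
    fix c d and s t :: real
    assume "c \<in> U" "d \<in> U" and st: "0 \<le> s" "0 \<le> t" "s + t = 1"
    then obtain \<delta>1 \<delta>2 where \<delta>: "\<delta>1 > 0" "x + \<delta>1 *\<^sub>R c \<in> X" "\<delta>2 > 0" "x + \<delta>2 *\<^sub>R d \<in> X"
      by (auto simp: U)
    define \<delta> where "\<delta> = min \<delta>1 \<delta>2"
    have "\<delta> > 0" "x + \<delta> *\<^sub>R c \<in> X" "x + \<delta> *\<^sub>R d \<in> X"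
      using \<delta> mono[of \<delta> \<delta>1 c] mono[of \<delta> \<delta>2 d] by (auto simp: \<delta>_def)
    then have "s *\<^sub>R (x + \<delta> *\<^sub>R c) + t *\<^sub>R (x + \<delta> *\<^sub>R d) \<in> X"
      using assms st by (intro convexD) auto
    also have "s *\<^sub>R (x + \<delta> *\<^sub>R c) + t *\<^sub>R (x + \<delta> *\<^sub>R d) = (s + t) *\<^sub>R x + \<delta> *\<^sub>R (s *\<^sub>R c + t *\<^sub>R d)"
      by (simp add: algebra_simps)
    finally show "s *\<^sub>R c + t *\<^sub>R d \<in> U" using \<open>\<delta> > 0\<close> st by (auto simp: U)
  qed
  then have "convex T" "closed T" by (auto simp: T_def U_def convex_closure)
  have "U \<subseteq> T" by (auto simp: T_def U_def closure_subset)
  have "0 \<in> U" using assms by (auto simp: U intro: exI[of _ 1])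
  then have "p \<in> closure U"
    using closest_point_in_set[OF \<open>closed T\<close>, of v] \<open>U \<subseteq> T\<close> by (auto simp: p_def T_def U_def)
  have qin: "x + \<delta> *\<^sub>R q \<delta> \<in> X" if "\<delta> > 0" for \<delta>
    using closest_point_in_set[OF \<open>closed X\<close>, of "x + \<delta> *\<^sub>R v"] assms that by (auto simp: q_def)
  have qle: "dist v (q \<delta>) \<le> dist v c" if "\<delta> > 0" "x + \<delta> *\<^sub>R c \<in> X" for \<delta> c
  proof -
    have "dist (x + \<delta> *\<^sub>R v) (x + \<delta> *\<^sub>R q \<delta>) \<le> dist (x + \<delta> *\<^sub>R v) (x + \<delta> *\<^sub>R c)"
      using closest_point_le[OF \<open>closed X\<close> that(2), of "x + \<delta> *\<^sub>R v"] that(1) by (simp add: q_def)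
    then show ?thesis using that(1) by (simp add: dist_norm flip: scaleR_diff_right)
  qed
  \<comment> \<open>A point \<open>c\<close> of \<open>U\<close> close to \<open>p\<close> is an
    admissible competitor for all small \<open>\<delta>\<close>, which bounds the distance above;
    membership of the quotient in \<open>T\<close> bounds it below.\<close>
  have lim: "((\<lambda>\<delta>. dist v (q \<delta>)) \<longlongrightarrow> dist v p) (at_right 0)"
  proof (rule tendstoI)
    fix e :: real
    assume "e > 0"
    then obtain c where c: "c \<in> U" "dist c p < e"
      using \<open>p \<in> closure U\<close> closure_approachable by metis
    then obtain \<delta>0 where "\<delta>0 > 0" "x + \<delta>0 *\<^sub>R c \<in> X" by (auto simp: U)
    have "dist (dist v (q \<delta>)) (dist v p) < e" if "0 < \<delta>" "\<delta> < \<delta>0" for \<delta>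
    proof -
      have "dist v (q \<delta>) \<le> dist v c"
        using qle[of \<delta> c] mono[of \<delta> \<delta>0 c] that \<open>x + \<delta>0 *\<^sub>R c \<in> X\<close> by auto
      also have "\<dots> < dist v p + e"
        using c(2) dist_triangle[of v c p] by (simp add: dist_commute)
      finally have "dist v (q \<delta>) < dist v p + e" .
      moreover have "q \<delta> \<in> T" using qin[OF that(1)] that(1) \<open>U \<subseteq> T\<close> U by blast
      then have "dist v p \<le> dist v (q \<delta>)"
        unfolding p_def by (rule closest_point_le[OF \<open>closed T\<close>])
      ultimately show ?thesis by (simp add: dist_real_def)
    qed
    then show "\<forall>\<^sub>F \<delta> in at_right 0. dist (dist v (q \<delta>)) (dist v p) < e"
      using \<open>\<delta>0 > 0\<close> by (auto simp: eventually_at_right_field)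
  qed
  \<comment> \<open>By the projection inequality for \<open>T\<close>, this square root dominates
    \<open>norm (q \<delta> - p)\<close>.\<close>
  have "((\<lambda>\<delta>. sqrt ((dist v (q \<delta>))\<^sup>2 - (dist v p)\<^sup>2)) \<longlongrightarrow> sqrt ((dist v p)\<^sup>2 - (dist v p)\<^sup>2)) (at_right 0)"
    by (intro tendsto_intros lim)
  then have "((\<lambda>\<delta>. sqrt ((dist v (q \<delta>))\<^sup>2 - (dist v p)\<^sup>2)) \<longlongrightarrow> 0) (at_right 0)"
    by simp
  moreover have "\<forall>\<^sub>F \<delta> in at_right 0. norm (q \<delta> - p) \<le> sqrt ((dist v (q \<delta>))\<^sup>2 - (dist v p)\<^sup>2)"
    using eventually_at_right_less
  proof eventually_elim
    case (elim \<delta>)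
    then have "q \<delta> \<in> T" using qin \<open>U \<subseteq> T\<close> U by blast
    then show ?case
      using closest_point_dist_sq_le[OF \<open>convex T\<close> \<open>closed T\<close>, of "q \<delta>" v]
      by (intro real_le_rsqrt) (simp add: p_def dist_norm)
  qed
  ultimately have "((\<lambda>\<delta>. q \<delta> - p) \<longlongrightarrow> 0) (at_right 0)"
    by (rule Lim_null_comparison[rotated])
  then show ?thesis by (simp add: LIM_zero_iff q_def p_def)
qed

text \<open>The obtuse angle inequality for the projection of
  \<open>x + \<delta> *\<^sub>R v\<close>, divided by \<open>\<delta>\<close>, passes to the limit
  because the projected point tends to \<open>x\<close>.\<close>

lemma closest_point_derivative_inner_le:
  fixes X :: "'a::euclidean_space set"
  assumes "closed X" "convex X" "x \<in> X" "y \<in> X"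
    and w: "((\<lambda>\<delta>. (closest_point X (x + \<delta> *\<^sub>R v) - x) /\<^sub>R \<delta>) \<longlongrightarrow> w) (at_right 0)"
  shows "(x - y) \<bullet> w \<le> (x - y) \<bullet> v"
proof -
  let ?P = "\<lambda>\<delta>. closest_point X (x + \<delta> *\<^sub>R v)"
  have idlim: "((\<lambda>\<delta>::real. x + \<delta> *\<^sub>R v) \<longlongrightarrow> x + 0 *\<^sub>R v) (at_right 0)"
    by (intro tendsto_intros)
  have "isCont (closest_point X) x"
    using assms by (intro continuous_at_closest_point) auto
  then have "(?P \<longlongrightarrow> x) (at_right 0)"
    using isCont_tendsto_compose[OF _ idlim, of "closest_point X"] closest_point_self[OF \<open>x \<in> X\<close>] by simp
  then have "((\<lambda>\<delta>. (v - (?P \<delta> - x) /\<^sub>R \<delta>) \<bullet> (y - ?P \<delta>)) \<longlongrightarrow> (v - w) \<bullet> (y - x)) (at_right 0)"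
    by (intro tendsto_intros w)
  moreover have "\<forall>\<^sub>F \<delta> in at_right 0. (v - (?P \<delta> - x) /\<^sub>R \<delta>) \<bullet> (y - ?P \<delta>) \<le> 0"
    using eventually_at_right_less
  proof eventually_elim
    case (elim \<delta>)
    have "(v - (?P \<delta> - x) /\<^sub>R \<delta>) = (x + \<delta> *\<^sub>R v - ?P \<delta>) /\<^sub>R \<delta>"
      using elim by (simp add: algebra_simps)
    then show ?case
      using closest_point_dot[OF \<open>convex X\<close> \<open>closed X\<close> \<open>y \<in> X\<close>, of "x + \<delta> *\<^sub>R v"] elim
      by (simp add: mult_nonneg_nonpos)
  qed
  ultimately have "(v - w) \<bullet> (y - x) \<le> 0"
    by (rule tendsto_upperbound) simp
  then show ?thesis by (simp add: algebra_simps inner_commute)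
qed

section \<open>Regret of the controller\<close>

text \<open>A convex function with subgradients everywhere may be discontinuous at the relative boundary
  of \<open>X\<close>, so the Caratheodory criterion applies only after moving \<open>y\<close> into the relative interior.\<close>

lemma borel_measurable_convex_comp:
  fixes f :: "real \<Rightarrow> real ^ 'n \<Rightarrow> real" and y :: "real \<Rightarrow> real ^ 'n"
  assumes meas: "\<And>c. c \<in> X \<Longrightarrow> (\<lambda>t. f t c) \<in> borel_measurable (lebesgue_on {a..b})"
    and conv: "\<And>t. t \<in> {a..b} \<Longrightarrow> convex_on X (f t)"
    and sub: "\<And>t. t \<in> {a..b} \<Longrightarrow> is_subgradient X (f t) (y t) (s t)"
    and y: "continuous_on {a..b} y" "y ` {a..b} \<subseteq> X" and "convex X"
  shows "(\<lambda>t. f t (y t)) \<in> borel_measurable (lebesgue_on {a..b})"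
proof (cases "X = {}")
  case False
  then obtain q where q: "q \<in> rel_interior X"
    using rel_interior_eq_empty[OF \<open>convex X\<close>] by auto
  then have "q \<in> X" using rel_interior_subset by blast
  define l where "l n = 1 / real (Suc n)" for n
  have l: "0 < l n" "l n \<le> 1" for n by (auto simp: l_def)
  have "l \<longlonglongrightarrow> 0"
    using LIMSEQ_inverse_real_of_nat by (simp add: l_def[abs_def] divide_inverse)
  \<comment> \<open>A contraction towards \<open>q\<close> puts the curve in the relative interior,
    where each \<open>f t\<close> is continuous.\<close>
  define z where "z n t = y t - l n *\<^sub>R (y t - q)" for n t
  have z_eq: "z n t = (1 - l n) *\<^sub>R y t + l n *\<^sub>R q" for n t
    by (simp add: z_def algebra_simps)
  have z_in: "z n t \<in> rel_interior X" if "t \<in> {a..b}" for n t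
    unfolding z_def using y(2) that by (intro rel_interior_convex_shrink[OF \<open>convex X\<close> q _ l]) auto
  show ?thesis
  proof (rule borel_measurable_LIMSEQ_real)
    show "(\<lambda>t. f t (z n t)) \<in> borel_measurable (lebesgue_on {a..b})" for n
    proof (rule borel_measurable_caratheodory_comp[where f = f and y = "z n" and S = "rel_interior X"])
      show "continuous_on (rel_interior X) (f t)" if "t \<in> {a..b}" for t
        using conv[OF that] by (rule convex_on_continuous_rel_interior)
      show "continuous_on {a..b} (z n)"
        unfolding z_def by (intro continuous_intros y)
    qed (use meas z_in rel_interior_subset in blast)+
    fix t assume "t \<in> space (lebesgue_on {a..b})"
    then have t: "t \<in> {a..b}" by simp
    then have "y t \<in> X" using y(2) by auto
    have up: "f t (z n t) \<le> (1 - l n) * f t (y t) + l n * f t q" for n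
      unfolding z_eq using convex_onD[OF conv[OF t]] l(1)[of n] l(2) \<open>y t \<in> X\<close> \<open>q \<in> X\<close> by simp
    \<comment> \<open>The subgradient at \<open>y t\<close> bounds the approximants below and
      convexity bounds them above, so they converge even where \<open>f t\<close> is
      discontinuous.\<close>
    have low: "f t (y t) - l n * (s t \<bullet> (y t - q)) \<le> f t (z n t)" for n
    proof -
      have "z n t \<in> X" using z_in[OF t] rel_interior_subset by blast
      then have "f t (y t) + s t \<bullet> (z n t - y t) \<le> f t (z n t)"
        using sub[OF t] by (simp add: is_subgradient_def)
      then show ?thesis by (simp add: z_def)
    qed
    show "(\<lambda>n. f t (z n t)) \<longlonglongrightarrow> f t (y t)"
    proof (rule tendsto_sandwich)
      have "(\<lambda>n. f t (y t) - l n * (s t \<bullet> (y t - q))) \<longlonglongrightarrow> f t (y t) - 0 * (s t \<bullet> (y t - q))"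
        by (intro tendsto_intros \<open>l \<longlonglongrightarrow> 0\<close>)
      then show "(\<lambda>n. f t (y t) - l n * (s t \<bullet> (y t - q))) \<longlonglongrightarrow> f t (y t)" by simp
      have "(\<lambda>n. (1 - l n) * f t (y t) + l n * f t q) \<longlonglongrightarrow> (1 - 0) * f t (y t) + 0 * f t q"
        by (intro tendsto_intros \<open>l \<longlonglongrightarrow> 0\<close>)
      then show "(\<lambda>n. (1 - l n) * f t (y t) + l n * f t q) \<longlonglongrightarrow> f t (y t)" by simp
    qed (use up low in auto)
  qed
next
  case True
  with y(2) have "{a..b} = {}" by auto
  then show ?thesis by (intro borel_measurableI) (auto simp: sets_restrict_space)
qed

text \<open>The upper bound \<open>G\<close> is known only through its gauge integral, as the
  fundamental theorem delivers it. Lying above the absolutely integrable \<open>L\<close> makes it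
  absolutely integrable, which then dominates \<open>h\<close>.\<close>

lemma absolutely_integrable_sandwich:
  fixes h :: "'a::euclidean_space \<Rightarrow> real"
  assumes h: "h \<in> borel_measurable (lebesgue_on S)" and S: "S \<in> sets lebesgue"
    and L: "L absolutely_integrable_on S" "\<And>t. t \<in> S \<Longrightarrow> L t \<le> h t"
    and G: "(G has_integral I) S" "negligible N" "\<And>t. t \<in> S - N \<Longrightarrow> h t \<le> G t"
  shows "h absolutely_integrable_on S" "integral S h \<le> I"
proof -
  \<comment> \<open>Replacing \<open>G\<close> by \<open>h\<close> on the null set makes the
    comparison valid on all of \<open>S\<close> without changing the integral.\<close>
  define G' where "G' t = (if t \<in> N then h t else G t)" for t
  have G': "(G' has_integral I) S"
    by (rule has_integral_spike[OF G(2) _ G(1)]) (simp add: G'_def)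
  have le: "h t \<le> G' t" if "t \<in> S" for t
    using G(3) that by (auto simp: G'_def)
  have "G' absolutely_integrable_on S"
    using L le by (intro absolutely_integrable_absolutely_integrable_lbound[OF has_integral_integrable[OF G'] L(1)]) force
  then have "(\<lambda>t. \<bar>L t\<bar> + \<bar>G' t\<bar>) absolutely_integrable_on S"
    using L(1) by (intro set_integral_add set_integrable_abs)
  then show "h absolutely_integrable_on S"
    using L(2) le
    by (intro measurable_bounded_by_integrable_imp_absolutely_integrable[OF h S, where g = "\<lambda>t. \<bar>L t\<bar> + \<bar>G' t\<bar>"])
       (use set_lebesgue_integral_eq_integral(1) in \<open>fastforce+\<close>)
  then show "integral S h \<le> I"
    using has_integral_le[OF integrable_integral G'] le set_lebesgue_integral_eq_integral(1) by blast
qed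

lemma abs_continuous_on_interval_imp_continuous_on:
  assumes "abs_continuous_on_interval a b x"
  shows "continuous_on {a..b} x"
  unfolding continuous_on_iff
proof safe
  fix t e :: real
  assume t: "t \<in> {a..b}" and "e > 0"
  then obtain d where "d > 0" and d: "\<And>\<D>. \<lbrakk>\<D> division_of \<Union>\<D>; \<Union>\<D> \<subseteq> {a..b};
      (\<Sum>K\<in>\<D>. Sup K - Inf K) < d\<rbrakk> \<Longrightarrow> (\<Sum>K\<in>\<D>. norm (x (Sup K) - x (Inf K))) < e"
    using assms[unfolded abs_continuous_on_interval_def, rule_format, OF \<open>e > 0\<close>] by blast
  have near: "dist (x v) (x u) < e" if "u \<in> {a..b}" "v \<in> {a..b}" "u \<le> v" "v - u < d" for u v
    using d[of "{cbox u v}"] division_of_self[of u v] that by (simp add: dist_norm)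
  have "dist (x s) (x t) < e" if "s \<in> {a..b}" "dist s t < d" for s
    using near[of s t] near[of t s] that t by (cases "s \<le> t") (auto simp: dist_commute dist_real_def)
  then show "\<exists>d>0. \<forall>s\<in>{a..b}. dist s t < d \<longrightarrow> dist (x s) (x t) < e"
    using \<open>d > 0\<close> by blast
qed

text \<open>The trajectory is bounded on the interval and the quadratic \<open>lyap c\<close> is
  Lipschitz on bounded sets, so the composition inherits absolute continuity.\<close>

lemma has_integral_lyap:
  fixes x :: "real \<Rightarrow> real ^ 'n"
  assumes "a \<le> b" "negligible N" and AC: "abs_continuous_on_interval a b x"
    and x': "\<And>t. t \<in> {a..b} - N \<Longrightarrow> (x has_vector_derivative x' t) (at t)"
  shows "((\<lambda>t. (x t - c) \<bullet> x' t) has_integral (lyap c (x b) - lyap c (x a))) {a..b}"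
proof (rule fundamental_theorem_of_calculus_abs_continuous[OF assms(1,2)])
  fix t assume t: "t \<in> {a..b} - N"
  have "(x has_derivative (\<lambda>h. h *\<^sub>R x' t)) (at t)"
    using x'[OF t] by (simp add: has_vector_derivative_def)
  then have "((\<lambda>t. lyap c (x t)) has_derivative
      (\<lambda>h. 1/2 * ((x t - c) \<bullet> (h *\<^sub>R x' t - 0) + (h *\<^sub>R x' t - 0) \<bullet> (x t - c)))) (at t)"
    unfolding lyap_def by (intro derivative_intros)
  then have "((\<lambda>t. lyap c (x t)) has_vector_derivative (x t - c) \<bullet> x' t) (at t)"
    by (simp add: has_vector_derivative_def inner_commute algebra_simps)
  then show "((\<lambda>t. lyap c (x t)) has_vector_derivative (x t - c) \<bullet> x' t) (at t within {a..b})"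
    by (rule has_vector_derivative_at_within)
next
  fix e :: real assume "e > 0"
  have "compact ((\<lambda>t. x t - c) ` {a..b})"
    using abs_continuous_on_interval_imp_continuous_on[OF AC]
    by (intro compact_continuous_image continuous_on_diff continuous_on_const) auto
  then have "bounded ((\<lambda>t. x t - c) ` {a..b})"
    by (rule compact_imp_bounded)
  then obtain M where "M > 0" and M: "\<And>t. t \<in> {a..b} \<Longrightarrow> norm (x t - c) \<le> M"
    unfolding bounded_pos by blast
  have lip: "norm (lyap c (x s) - lyap c (x t)) \<le> M * norm (x s - x t)"
    if "s \<in> {a..b}" "t \<in> {a..b}" for s t
  proof -
    have "(u + w) \<bullet> (u - w) = u \<bullet> u - w \<bullet> w" for u w :: "real ^ 'n"
      by (simp add: inner_add_left inner_diff_right inner_commute[of w u])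
    from this[of "x s - c" "x t - c"] have "lyap c (x s) - lyap c (x t) = 1/2 * (((x s - c) + (x t - c)) \<bullet> (x s - x t))"
      by (simp add: lyap_def)
    also have "norm \<dots> \<le> 1/2 * (norm ((x s - c) + (x t - c)) * norm (x s - x t))"
      using Cauchy_Schwarz_ineq2[of "(x s - c) + (x t - c)" "x s - x t"] by (simp add: abs_mult)
    also have "\<dots> \<le> 1/2 * ((M + M) * norm (x s - x t))"
      using M that by (intro mult_left_mono mult_right_mono norm_triangle_mono) auto
    finally show ?thesis by simp
  qed
  obtain d where "d > 0" and d: "\<And>\<D>. \<lbrakk>\<D> division_of \<Union>\<D>; \<Union>\<D> \<subseteq> {a..b};
      (\<Sum>K\<in>\<D>. Sup K - Inf K) < d\<rbrakk> \<Longrightarrow> (\<Sum>K\<in>\<D>. norm (x (Sup K) - x (Inf K))) < e / M"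
    using AC[unfolded abs_continuous_on_interval_def, rule_format,
        OF divide_pos_pos[OF \<open>e > 0\<close> \<open>M > 0\<close>]] by blast
  have "(\<Sum>K\<in>\<D>. norm (lyap c (x (Sup K)) - lyap c (x (Inf K)))) < e"
    if \<D>: "\<D> division_of \<Union>\<D>" "\<Union>\<D> \<subseteq> {a..b}" "(\<Sum>K\<in>\<D>. Sup K - Inf K) < d" for \<D>
  proof -
    have ends: "Sup K \<in> {a..b} \<and> Inf K \<in> {a..b}" if "K \<in> \<D>" for K
    proof -
      obtain u v where K: "K = cbox u v" using division_ofD(4)[OF \<D>(1) \<open>K \<in> \<D>\<close>] by blast
      then have "u \<le> v" using division_ofD(3)[OF \<D>(1) \<open>K \<in> \<D>\<close>] by auto
      with K have "Sup K \<in> K" "Inf K \<in> K" by auto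
      then show ?thesis using \<D>(2) \<open>K \<in> \<D>\<close> by blast
    qed
    have "(\<Sum>K\<in>\<D>. norm (lyap c (x (Sup K)) - lyap c (x (Inf K))))
        \<le> M * (\<Sum>K\<in>\<D>. norm (x (Sup K) - x (Inf K)))"
      unfolding sum_distrib_left using ends by (intro sum_mono lip) auto
    also have "\<dots> < M * (e / M)"
      using d[OF \<D>] \<open>M > 0\<close> by (intro mult_strict_left_mono)
    finally show ?thesis using \<open>M > 0\<close> by simp
  qed
  then show "\<exists>d>0. \<forall>\<D>. \<D> division_of \<Union>\<D> \<and> \<Union>\<D> \<subseteq> {a..b} \<and> (\<Sum>K\<in>\<D>. Sup K - Inf K) < d \<longrightarrow>
      (\<Sum>K\<in>\<D>. norm (lyap c (x (Sup K)) - lyap c (x (Inf K)))) < e"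
    using \<open>d > 0\<close> by blast
qed

text \<open>The operator \<open>Lim\<close> is a definite description, informative only once
  convergence is known; the tangent cone result supplies it.\<close>

lemma proj_dir_inner_le:
  assumes "closed X" "convex X" "x \<in> X" "y \<in> X"
  shows "(x - y) \<bullet> proj_dir X x v \<le> (x - y) \<bullet> v"
proof -
  note lim = tendsto_closest_point_difference_quotient[OF assms(1-3), of v]
  show ?thesis
    unfolding proj_dir_def tendsto_Lim[OF trivial_limit_at_right_real lim]
    by (rule closest_point_derivative_inner_le[OF assms lim])
qed

text \<open>Any point of \<open>X\<close> can serve as the comparator \<open>c\<close>: the decay of
  \<open>lyap c\<close> pays for the cost difference at each time.\<close>

lemma regret_le_lyap:
  fixes X :: "(real ^ 'n) set"
  assumes X: "closed X" "convex X"
    and int: "\<And>y. y \<in> X \<Longrightarrow> (\<lambda>t. f t y) absolutely_integrable_on {0..T}"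
    and conv: "\<And>t. t \<in> {0..T} \<Longrightarrow> convex_on X (f t)"
    and sub: "\<And>t y. t \<in> {0..T} \<Longrightarrow> y \<in> X \<Longrightarrow> is_subgradient X (f t) y (g t y)"
    and "\<epsilon> > 0" "T > 0" and sol: "controller_solution X \<epsilon> g x" and "c \<in> X"
  shows "regret f x T c \<le> 1 / \<epsilon> * lyap c (x 0)"
proof -
  define x' where "x' t = proj_dir X (x t) (- \<epsilon> *\<^sub>R g t (x t))" for t
  have xX: "x t \<in> X" if "t \<ge> 0" for t
    using sol that by (simp add: controller_solution_def)
  have AC: "abs_continuous_on_interval 0 T x"
    using sol \<open>T > 0\<close> by (simp add: controller_solution_def)
  have cont: "continuous_on {0..T} x"
    by (rule abs_continuous_on_interval_imp_continuous_on[OF AC])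
  have "AE t in lebesgue. t > 0 \<longrightarrow> (x has_vector_derivative x' t) (at t)"
    using sol by (simp add: controller_solution_def x'_def)
  then obtain N0 where N0: "negligible N0"
      "{t. \<not> (t > 0 \<longrightarrow> (x has_vector_derivative x' t) (at t))} \<subseteq> N0"
    by (auto simp: eventually_ae_filter negligible_iff_null_sets)
  \<comment> \<open>The equation holds only at positive times, so the initial time joins the
    exceptional set.\<close>
  define N where "N = insert 0 N0"
  have N: "negligible N" using N0 by (simp add: N_def)
  have deriv: "(x has_vector_derivative x' t) (at t)" if "t \<in> {0..T} - N" for t
  proof -
    have "t > 0" "t \<notin> N0" using that by (auto simp: N_def less_le)
    then show ?thesis using N0(2) by blast
  qed
  note lyap_int = has_integral_lyap[OF less_imp_le[OF \<open>T > 0\<close>] N AC deriv, of c]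
  have fc_int: "((\<lambda>t. f t c) has_integral (LINT t:{0..T}|lebesgue. f t c)) {0..T}"
    by (rule has_integral_set_lebesgue[OF int[OF \<open>c \<in> X\<close>]])
  have decay: "f t (x t) \<le> f t c - 1/\<epsilon> * ((x t - c) \<bullet> x' t)" if "t \<in> {0..T}" for t
  proof -
    \<comment> \<open>The projection only helps descent towards \<open>c\<close>; after dividing by
      \<open>\<epsilon>\<close>, the subgradient inequality at \<open>x t\<close> tested with
      \<open>c\<close> gives the cost difference.\<close>
    have "(x t - c) \<bullet> x' t \<le> (x t - c) \<bullet> (- \<epsilon> *\<^sub>R g t (x t))"
      unfolding x'_def using that by (intro proj_dir_inner_le X xX \<open>c \<in> X\<close>) auto
    then have "1/\<epsilon> * ((x t - c) \<bullet> x' t) \<le> 1/\<epsilon> * ((x t - c) \<bullet> (- \<epsilon> *\<^sub>R g t (x t)))"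
      using \<open>\<epsilon> > 0\<close> by (intro mult_left_mono) auto
    also have "\<dots> = g t (x t) \<bullet> (c - x t)"
      using \<open>\<epsilon> > 0\<close> by (simp add: inner_diff_left inner_diff_right inner_commute)
    also have "\<dots> \<le> f t c - f t (x t)"
      using sub[OF that, of "x t"] xX that \<open>c \<in> X\<close> by (force simp: is_subgradient_def)
    finally show ?thesis by simp
  qed
  have "x ` {0..T} \<subseteq> X" "bounded (x ` {0..T})" "x ` {0..T} \<noteq> {}"
    using xX \<open>T > 0\<close> compact_imp_bounded[OF compact_continuous_image[OF cont]] by auto
  then obtain B q k m where B: "finite B" "B \<subseteq> X" "q \<in> X" and
    lower: "\<And>h y. convex_on X h \<Longrightarrow> y \<in> x ` {0..T} \<Longrightarrow> k * h q - m * (\<Sum>b\<in>B. \<bar>h b\<bar>) \<le> h y"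
    using convex_on_bounded_subset_lower_bound[OF X(2)] by metis
  have meas: "(\<lambda>t. f t (x t)) \<in> borel_measurable (lebesgue_on {0..T})"
  proof (rule borel_measurable_convex_comp[where X = X and s = "\<lambda>t. g t (x t)"])
    show "(\<lambda>t. f t y) \<in> borel_measurable (lebesgue_on {0..T})" if "y \<in> X" for y
      using int[OF that] by (rule absolutely_integrable_imp_borel_measurable) simp
    show "is_subgradient X (f t) (x t) (g t (x t))" if "t \<in> {0..T}" for t
      using that by (intro sub xX) auto
  qed (use conv cont xX X in auto)
  have "(\<lambda>t. k * f t q - m * (\<Sum>b\<in>B. \<bar>f t b\<bar>)) absolutely_integrable_on {0..T}"
    using B int by (intro set_integral_diff set_integrable_mult_right absolutely_integrable_sum set_integrable_abs) auto
  note sandwich = absolutely_integrable_sandwich[OF meas _ this _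
      has_integral_diff[OF fc_int has_integral_mult_right[OF lyap_int, of "1/\<epsilon>"]] N]
  have "(\<lambda>t. f t (x t)) absolutely_integrable_on {0..T}"
    by (rule sandwich(1)) (use decay lower conv in auto)
  then have "(LINT t:{0..T}|lebesgue. f t (x t)) = integral {0..T} (\<lambda>t. f t (x t))"
    by (rule set_lebesgue_integral_eq_integral)
  also have "\<dots> \<le> (LINT t:{0..T}|lebesgue. f t c) - 1/\<epsilon> * (lyap c (x T) - lyap c (x 0))"
    by (rule sandwich(2)) (use decay lower conv in auto)
  finally have "regret f x T c \<le> 1/\<epsilon> * lyap c (x 0) - 1/\<epsilon> * lyap c (x T)"
    by (simp add: regret_def algebra_simps)
  moreover have "1/\<epsilon> * lyap c (x T) \<ge> 0"
    using \<open>\<epsilon> > 0\<close> by (simp add: lyap_def)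
  ultimately show ?thesis by linarith
qed

theorem theorem1:
  fixes X :: "(real ^ 'n) set"
    and f :: "real \<Rightarrow> real ^ 'n \<Rightarrow> real"
    and g :: "real \<Rightarrow> real ^ 'n \<Rightarrow> real ^ 'n"
    and x :: "real \<Rightarrow> real ^ 'n"
    and \<epsilon> :: real
  assumes "closed X" and "convex X"
    and "\<And>T y. T > 0 \<Longrightarrow> y \<in> X \<Longrightarrow> (\<lambda>t. f t y) absolutely_integrable_on {0..T}"
    and "\<And>T t. T > 0 \<Longrightarrow> t \<in> {0..T} \<Longrightarrow> convex_on X (f t)"
    and "\<And>t y. t \<ge> 0 \<Longrightarrow> y \<in> X \<Longrightarrow> is_subgradient X (f t) y (g t y)"
    and "\<epsilon> > 0"
    and "x 0 \<in> X"
    and "controller_solution X \<epsilon> g x"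
  shows "(\<forall>B. bounded B \<longrightarrow> strongly_optimal_wrt B X f x) \<and>
    (\<forall>T>0. \<forall>xs. hindsight_opt X f T xs \<longrightarrow> regret f x T xs \<le> 1 / \<epsilon> * lyap xs (x 0))"
proof (intro conjI allI impI)
  have bound: "xs \<in> X \<and> regret f x T xs \<le> 1 / \<epsilon> * lyap xs (x 0)"
    if "T > 0" "hindsight_opt X f T xs" for T xs
  proof
    show "xs \<in> X" using that(2) by (simp add: hindsight_opt_def is_arg_min_def)
    then show "regret f x T xs \<le> 1 / \<epsilon> * lyap xs (x 0)"
      using assms that(1) by (intro regret_le_lyap[where X = X and g = g]) auto
  qed
  show "regret f x T xs \<le> 1 / \<epsilon> * lyap xs (x 0)" if "T > 0" "hindsight_opt X f T xs" for T xs
    using bound[OF that] by (rule conjunct2)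
  fix B :: "(real ^ 'n) set"
  assume "bounded B"
  \<comment> \<open>The radius is measured from the initial state, so
    \<open>R\<^sup>2 / (2 \<epsilon>)\<close> bounds the regret uniformly in the horizon and in the
    optima from \<open>B\<close>.\<close>
  then obtain R where R: "\<And>y. y \<in> B \<Longrightarrow> dist (x 0) y \<le> R"
    using bounded_any_center[of B "x 0"] by blast
  have "regret f x T xs \<le> 1 / \<epsilon> * (1/2 * R\<^sup>2)" if "T > 0" "xs \<in> B" "hindsight_opt X f T xs" for T xs
  proof -
    have "lyap xs (x 0) = 1/2 * (norm (x 0 - xs))\<^sup>2"
      by (simp add: lyap_def power2_norm_eq_inner)
    also have "\<dots> \<le> 1/2 * R\<^sup>2"
      using R[OF that(2)] by (intro mult_left_mono power_mono) (auto simp: dist_norm)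
    finally have "1 / \<epsilon> * lyap xs (x 0) \<le> 1 / \<epsilon> * (1/2 * R\<^sup>2)"
      using \<open>\<epsilon> > 0\<close> by (intro mult_left_mono) auto
    with bound[OF that(1,3)] show ?thesis by linarith
  qed
  then show "strongly_optimal_wrt B X f x"
    unfolding strongly_optimal_wrt_def by blast
qed

end
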